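(* Assume $1<p_i<+\infty$ for $i=1,\dots,m$. Let $a,b,c\in\mathbb{R}^d$ be consecutive breaking points of a geodesic path such that $a\in P_i\setminus F_{ij}$, $b\in F_{ij}$ and $c\in P_j\setminus F_{ij}$ (where $i,j$ are the consecutive cells of the path whose gate point in $F_{ij}$ is $b$). Let $\mathcal{F}_b$ be the face of $F_{ij}$ such that $b$ lies in the relative interior of $\mathcal{F}_b$. Then, for each vector $v\in L(\mathrm{aff}(\mathcal{F}_b))$, the gate point $b$ satisfies $$\omega_i\left(\left[\frac{b-a}{\|b-a\|_{p_i}}\right]^\circ\right)^T v=\omega_j\left(\left[\frac{c-b}{\|c-b\|_{p_j}}\right]^\circ\right)^T v,$$ or equivalently, $$\omega_i\left(\frac{(b-a)^\circ}{\|(b-a)^\circ\|_{p_i^\circ}}\right)^T v=\omega_j\left(\frac{(c-b)^\circ}{\|(c-b)^\circ\|_{p_j^\circ}}\right)^T v,$$ where the polar vectors involving $b-a$ are taken in $(\mathbb{R}^d,\|\cdot\|_{p_i})$ and those involving $c-b$ in $(\mathbb{R}^d,\|\cdot\|_{p_j})$.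
   Context: Setting. $P_1,\dots,P_m\subseteq\mathbb{R}^d$ are the cells of a polyhedral subdivision, with $\mathrm{int}(P_i)\cap\mathrm{int}(P_j)=\emptyset$ for $i\ne j$; the cells are assumed to be polytopes (bounded polyhedra). Cell $P_i$ is endowed with the $\ell_{p_i}$-norm $\|\cdot\|_{p_i}$ and a weight $\omega_i>0$. The undirected graph $G=(V,E)$ has $V=\{1,\dots,m\}$ and $\{i,j\}\in E$ ($i\neq j$) iff $P_i$ and $P_j$ have a common (nonempty) face; for $\{i,j\}\in E$, $F_{ij}=F_{ji}=P_i\cap P_j$ is their maximal common face. Points $x_s\in P_s$, $x_t\in P_t$, $s\ne t$, are given, and $\Gamma$ is the set of simple paths $(s,i_1,\dots,i_k,t)$ from $s$ to $t$ in $G$ (all vertices distinct). Geodesic path. Fix $\gamma=(i_0,i_1,\dots,i_k,i_{k+1})\in\Gamma$ with $i_0=s$, $i_{k+1}=t$. Let the gate points $y_{i_r i_{r+1}}\in F_{i_r i_{r+1}}$, $r=0,\dots,k$, minimize, over $F_{i_0i_1}\times\dots\times F_{i_ki_{k+1}}$, $$\omega_s\|y_{s i_1}-x_s\|_{p_s}+\sum_{r=1}^{k}\omega_{i_r}\|y_{i_r i_{r+1}}-y_{i_{r-1}i_r}\|_{p_{i_r}}+\omega_t\|x_t-y_{i_k t}\|_{p_t}.$$ The piecewise linear path through $x_s,y_{si_1},y_{i_1i_2},\dots,y_{i_kt},x_t$ (in this order) is called a geodesic path between $x_s$ and $x_t$, and these points are its breaking points. Notation. $\mathrm{aff}(S)$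 is the affine hull of $S$; for an affine set $S$, $L(S)=\{x-x':x,x'\in S\}$. For $p\in(1,+\infty)$, $p^\circ=p/(p-1)$. The polar vector of a nonzero vector $v$ in $(\mathbb{R}^d,\|\cdot\|_p)$ is $v^\circ=(v_1^\circ,\dots,v_d^\circ)^T$ with $v_k^\circ=\left(\frac{|v_k|}{\|v\|_p}\right)^{p-1}\mathrm{sign}(v_k)\,\|v\|_p$; the polar vector of $0$ is $0$. *)

theory Defs
  imports "HOL-Analysis.Analysis"
begin

definition lp_norm :: "real \<Rightarrow> real ^ 'd \<Rightarrow> real" where
  "lp_norm p v = (\<Sum>k\<in>UNIV. \<bar>v $ k\<bar> powr p) powr (1 / p)"

definition conj_exp :: "real \<Rightarrow> real" where
  "conj_exp p = p / (p - 1)"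

definition polar_vec :: "real \<Rightarrow> real ^ 'd \<Rightarrow> real ^ 'd" where
  "polar_vec p v = (if v = 0 then 0
     else (\<chi> k. (\<bar>v $ k\<bar> / lp_norm p v) powr (p - 1) * sgn (v $ k) * lp_norm p v))"

text \<open>The cells are \<open>P 1, \<dots>, P m\<close> and meet face to face (possibly in the empty face). Cells
  need not be full-dimensional; disjointness of interiors is automatic for those that are not.\<close>

definition polytopal_subdivision :: "nat \<Rightarrow> (nat \<Rightarrow> (real ^ 'd) set) \<Rightarrow> bool" where
  "polytopal_subdivision m P \<longleftrightarrow>
     (\<forall>i\<in>{1..m}. polytope (P i)) \<and>
     (\<forall>i\<in>{1..m}. \<forall>j\<in>{1..m}. i \<noteq> j \<longrightarrow>
        interior (P i) \<inter> interior (P j) = {} \<and>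
        (P i \<inter> P j) face_of P i \<and> (P i \<inter> P j) face_of P j)"

definition cell_edges :: "nat \<Rightarrow> (nat \<Rightarrow> (real ^ 'd) set) \<Rightarrow> nat set set" where
  "cell_edges m P = {{i, j} | i j. i \<in> {1..m} \<and> j \<in> {1..m} \<and> i \<noteq> j \<and>
     (\<exists>F. F \<noteq> {} \<and> F face_of P i \<and> F face_of P j)}"

definition common_face :: "(nat \<Rightarrow> (real ^ 'd) set) \<Rightarrow> nat \<Rightarrow> nat \<Rightarrow> (real ^ 'd) set" where
  "common_face P i j = P i \<inter> P j"

definition simple_cell_paths ::
    "nat \<Rightarrow> (nat \<Rightarrow> (real ^ 'd) set) \<Rightarrow> nat \<Rightarrow> nat \<Rightarrow> nat list set" where
  "simple_cell_paths m P s t = {\<gamma>. \<gamma> \<noteq> [] \<and> hd \<gamma> = s \<and> last \<gamma> = t \<and>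
     set \<gamma> \<subseteq> {1..m} \<and> distinct \<gamma> \<and>
     (\<forall>r. Suc r < length \<gamma> \<longrightarrow> {\<gamma> ! r, \<gamma> ! Suc r} \<in> cell_edges m P)}"

text \<open>A choice of gate points along \<open>\<gamma>\<close> is a list \<open>ys\<close> whose entry \<open>ys ! r\<close> is the gate point
  between the cells \<open>\<gamma> ! r\<close> and \<open>\<gamma> ! Suc r\<close>.\<close>

definition gate_points :: "(nat \<Rightarrow> (real ^ 'd) set) \<Rightarrow> nat list \<Rightarrow> (real ^ 'd) list set" where
  "gate_points P \<gamma> = {ys. Suc (length ys) = length \<gamma> \<and>
     (\<forall>r < length ys. ys ! r \<in> common_face P (\<gamma> ! r) (\<gamma> ! Suc r))}"

text \<open>With \<open>bs = xs # ys @ [xt]\<close>, the points \<open>bs ! r\<close> and \<open>bs ! Suc r\<close> are the ends of the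
  segment of the path that lies in the cell \<open>\<gamma> ! r\<close>.\<close>

definition path_length ::
    "(nat \<Rightarrow> real) \<Rightarrow> (nat \<Rightarrow> real) \<Rightarrow> nat list \<Rightarrow> (real ^ 'd) list \<Rightarrow> real" where
  "path_length \<omega> p \<gamma> bs =
     (\<Sum>r < length \<gamma>. \<omega> (\<gamma> ! r) * lp_norm (p (\<gamma> ! r)) (bs ! Suc r - bs ! r))"

definition geodesic_breaking_points ::
    "(nat \<Rightarrow> (real ^ 'd) set) \<Rightarrow> (nat \<Rightarrow> real) \<Rightarrow> (nat \<Rightarrow> real) \<Rightarrow> nat list \<Rightarrow>
     real ^ 'd \<Rightarrow> real ^ 'd \<Rightarrow> (real ^ 'd) list \<Rightarrow> bool" where
  "geodesic_breaking_points P \<omega> p \<gamma> xs xt bs \<longleftrightarrow>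
     (\<exists>ys. bs = xs # ys @ [xt] \<and>
        is_arg_min (\<lambda>zs. path_length \<omega> p \<gamma> (xs # zs @ [xt])) (\<lambda>zs. zs \<in> gate_points P \<gamma>) ys)"

definition difference_space :: "(real ^ 'd) set \<Rightarrow> (real ^ 'd) set" where
  "difference_space S = {x - x' | x x'. x \<in> S \<and> x' \<in> S}"

end

theory Submission
  imports Defs
begin

text \<open>Moving the gate point \<open>b\<close> along \<open>v\<close> keeps it in \<open>Fb\<close> for small steps, because \<open>b\<close> is in the
  relative interior, and changes only two terms of the path length. The resulting one-variable
  function has a local minimum at \<open>0\<close>; it is differentiable there since \<open>a \<noteq> b \<noteq> c\<close>, the gradient
  of the \<open>p\<close>-norm at \<open>w \<noteq> 0\<close> being the polar of \<open>w\<close> normalised in the \<open>p\<close>-norm.\<close>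

text \<open>At 0 the difference quotient is bounded by \<open>\<bar>h\<bar> powr (p - 1)\<close>,
  which vanishes in the limit because \<open>1 < p\<close>. Including this point matters: a nonzero
  vector may still have zero coordinates.\<close>

lemma has_real_derivative_abs_powr:
  fixes x p :: real
  assumes "1 < p"
  shows "((\<lambda>x. \<bar>x\<bar> powr p) has_real_derivative p * \<bar>x\<bar> powr (p - 1) * sgn x) (at x)"
proof (cases "x = 0")
  case True
  have lim: "((\<lambda>h. \<bar>h\<bar> powr (p - 1)) \<longlongrightarrow> 0) (at (0::real))"
  proof -
    have "((\<lambda>h::real. \<bar>h\<bar> powr (p - 1)) \<longlongrightarrow> \<bar>0\<bar> powr (p - 1)) (at 0)"
      using assms by (intro tendsto_powr2 tendsto_intros) auto
    then show ?thesis by simp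
  qed
  have "((\<lambda>h. (\<bar>h\<bar> powr p) / h) \<longlongrightarrow> 0) (at (0::real))"
  proof (rule Lim_null_comparison[OF _ lim])
    have "norm (\<bar>h\<bar> powr p / h) \<le> \<bar>h\<bar> powr (p - 1)" if "h \<noteq> 0" for h :: real
      using that by (simp add: powr_diff)
    then show "\<forall>\<^sub>F h in at 0. norm (\<bar>h\<bar> powr p / h) \<le> \<bar>h\<bar> powr (p - 1)"
      by (auto simp: eventually_at_filter)
  qed
  then show ?thesis
    using True by (simp add: DERIV_def)
next
  case False
  have "((\<lambda>x. \<bar>x\<bar>) has_real_derivative sgn x) (at x)"
    unfolding has_field_derivative_def
    by (rule has_derivative_eq_rhs[OF has_derivative_norm[OF False, unfolded real_norm_def]])
      (simp add: fun_eq_iff)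
  from DERIV_powr[OF this _ DERIV_const, of p] False show ?thesis
    by (simp add: powr_diff field_simps)
qed

lemma lp_norm_pos:
  assumes "w \<noteq> 0"
  shows "0 < lp_norm p w"
proof -
  obtain k where "w $ k \<noteq> 0"
    using assms by (metis vec_eq_iff zero_index)
  then have "0 < (\<Sum>k\<in>UNIV. \<bar>w $ k\<bar> powr p)"
    by (intro sum_pos2[of _ k]) auto
  then show ?thesis
    by (simp add: lp_norm_def)
qed

lemma lp_norm_powr:
  assumes "p \<noteq> 0"
  shows "lp_norm p w powr p = (\<Sum>k\<in>UNIV. \<bar>w $ k\<bar> powr p)"
  using assms by (simp add: lp_norm_def powr_powr sum_nonneg)

lemma lp_norm_scaleR:
  assumes "p \<noteq> 0"
  shows "lp_norm p (c *\<^sub>R w) = \<bar>c\<bar> * lp_norm p w"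
proof -
  have "(\<Sum>k\<in>UNIV. \<bar>(c *\<^sub>R w) $ k\<bar> powr p) = \<bar>c\<bar> powr p * (\<Sum>k\<in>UNIV. \<bar>w $ k\<bar> powr p)"
    by (simp add: abs_mult powr_mult sum_distrib_left)
  then show ?thesis
    using assms by (simp add: lp_norm_def powr_mult powr_powr sum_nonneg)
qed

text \<open>After scaling to unit \<open>p\<close>-norm, the trailing norm factor in the definition
  of the polar vector becomes 1.\<close>

lemma polar_vec_normalised_nth:
  assumes "p \<noteq> 0" "w \<noteq> 0"
  shows "polar_vec p ((1 / lp_norm p w) *\<^sub>R w) $ k =
    (\<bar>w $ k\<bar> / lp_norm p w) powr (p - 1) * sgn (w $ k)"
  using lp_norm_pos[OF assms(2), of p] assms
  by (simp add: polar_vec_def lp_norm_scaleR sgn_mult)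

text \<open>Polarity preserves length between dual norms: with \<open>q = conj_exp p\<close>, the
  identity \<open>(p - 1) * q = p\<close> turns \<open>q\<close>-th powers of polar coordinates into
  \<open>p\<close>-th powers of the original ones.\<close>

lemma lp_norm_polar_vec:
  assumes "1 < p" "w \<noteq> 0"
  shows "lp_norm (conj_exp p) (polar_vec p w) = lp_norm p w"
proof -
  define n where "n = lp_norm p w"
  define q where "q = conj_exp p"
  have n: "0 < n" and q: "q \<noteq> 0" and pq: "(p - 1) * q = p"
    using lp_norm_pos[OF assms(2)] assms(1) by (auto simp: n_def q_def conj_exp_def)
  have nth: "\<bar>polar_vec p w $ k\<bar> powr q = (\<bar>w $ k\<bar> powr p / n powr p) * n powr q" for k
    using n assms(2) pq
    by (cases "w $ k = 0")
      (simp_all add: polar_vec_def abs_mult powr_mult powr_powr powr_divide abs_sgn_eq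
        flip: n_def)
  have "lp_norm q (polar_vec p w) = ((\<Sum>k\<in>UNIV. \<bar>w $ k\<bar> powr p) / n powr p * n powr q) powr (1 / q)"
    by (simp only: lp_norm_def nth sum_distrib_right sum_divide_distrib)
  also have "\<dots> = (n powr q) powr (1 / q)"
    using lp_norm_powr[of p w, symmetric] n assms(1) by (simp flip: n_def)
  also have "\<dots> = n"
    using n q by (simp add: powr_powr)
  finally show ?thesis
    by (simp add: n_def q_def)
qed

text \<open>Polarity is positively homogeneous and norm preserving, so normalising commutes with it.
  This reduces the second form of the optimality condition to the first.\<close>

lemma polar_vec_normalised:
  assumes "1 < p" "w \<noteq> 0"
  shows "(1 / lp_norm (conj_exp p) (polar_vec p w)) *\<^sub>R polar_vec p w =
    polar_vec p ((1 / lp_norm p w) *\<^sub>R w)"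
  using assms lp_norm_pos[OF assms(2), of p]
  by (simp add: vec_eq_iff lp_norm_polar_vec polar_vec_normalised_nth) (simp add: polar_vec_def)

lemma has_real_derivative_lp_norm_line:
  assumes p: "1 < p" and w: "w \<noteq> 0"
  shows "((\<lambda>u. lp_norm p (w + u *\<^sub>R v)) has_real_derivative
    polar_vec p ((1 / lp_norm p w) *\<^sub>R w) \<bullet> v) (at 0)"
proof -
  define n where "n = lp_norm p w"
  define S where "S u = (\<Sum>k\<in>UNIV. \<bar>(w + u *\<^sub>R v) $ k\<bar> powr p)" for u
  define D where "D = (\<Sum>k\<in>UNIV. p * \<bar>w $ k\<bar> powr (p - 1) * sgn (w $ k) * v $ k)"
  have n: "0 < n"
    using lp_norm_pos[OF w] by (simp add: n_def)
  have S0: "S 0 = n powr p"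
    using p by (simp add: S_def n_def lp_norm_powr)
  have "((\<lambda>u. \<bar>(w + u *\<^sub>R v) $ k\<bar> powr p) has_real_derivative
      p * \<bar>w $ k\<bar> powr (p - 1) * sgn (w $ k) * v $ k) (at 0)" for k
  proof -
    have "((\<lambda>u. w $ k + u * v $ k) has_real_derivative v $ k) (at 0)"
      by (auto intro!: derivative_eq_intros)
    from DERIV_chain2[OF _ this, of "\<lambda>x. \<bar>x\<bar> powr p"] has_real_derivative_abs_powr[OF p, of "w $ k"]
    show ?thesis by simp
  qed
  then have "(S has_real_derivative D) (at 0)"
    unfolding S_def D_def by (intro DERIV_sum) auto
  \<comment> \<open>The outer \<open>p\<close>-th root is differentiable here because
    \<open>S 0 = n powr p\<close> is positive.\<close>
  from DERIV_powr[OF this _ DERIV_const, of "1 / p"]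
  have "((\<lambda>u. S u powr (1 / p)) has_real_derivative
      S 0 powr (1 / p) * (D * (1 / p) / S 0)) (at 0)"
    using n S0 by simp
  moreover have "S 0 powr (1 / p) * (D * (1 / p) / S 0) = polar_vec p ((1 / n) *\<^sub>R w) \<bullet> v"
  proof -
    have "S 0 powr (1 / p) * (D * (1 / p) / S 0) = (D / p) * (n / n powr p)"
      using n p by (simp add: S0 powr_powr)
    \<comment> \<open>This power of \<open>n\<close> is the denominator in the coordinates of the
      polar vector of the normalised \<open>w\<close>.\<close>
    also have "n / n powr p = 1 / n powr (p - 1)"
      using n by (simp add: powr_diff)
    also have "D / p = (\<Sum>k\<in>UNIV. \<bar>w $ k\<bar> powr (p - 1) * sgn (w $ k) * v $ k)"
      using p by (simp add: D_def sum_divide_distrib mult.assoc)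
    also have "\<dots> * (1 / n powr (p - 1)) = polar_vec p ((1 / n) *\<^sub>R w) \<bullet> v"
      using p w n unfolding n_def
      by (simp add: inner_vec_def polar_vec_normalised_nth sum_divide_distrib powr_divide)
    finally show ?thesis .
  qed
  ultimately show ?thesis
    by (simp add: lp_norm_def S_def n_def)
qed

text \<open>The point at index \<open>Suc r\<close> ends the segment in cell
  \<open>\<gamma> ! r\<close> and starts the one in \<open>\<gamma> ! Suc r\<close>; every other
  summand cancels.\<close>

lemma path_length_update:
  assumes r: "Suc r < length \<gamma>" and len: "length bs = Suc (length \<gamma>)"
  shows "path_length \<omega> p \<gamma> (bs[Suc r := z]) - path_length \<omega> p \<gamma> bs =
    (\<omega> (\<gamma> ! r) * lp_norm (p (\<gamma> ! r)) (z - bs ! r)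
      + \<omega> (\<gamma> ! Suc r) * lp_norm (p (\<gamma> ! Suc r)) (bs ! Suc (Suc r) - z))
    - (\<omega> (\<gamma> ! r) * lp_norm (p (\<gamma> ! r)) (bs ! Suc r - bs ! r)
      + \<omega> (\<gamma> ! Suc r) * lp_norm (p (\<gamma> ! Suc r)) (bs ! Suc (Suc r) - bs ! Suc r))"
proof -
  let ?T = "\<lambda>bs q. \<omega> (\<gamma> ! q) * lp_norm (p (\<gamma> ! q)) (bs ! Suc q - bs ! q)"
  have split: "path_length \<omega> p \<gamma> cs = ?T cs r + (?T cs (Suc r) +
      sum (?T cs) ({..<length \<gamma>} - {r} - {Suc r}))" for cs
    using r unfolding path_length_def
    by (subst sum.remove[of _ r], simp, simp, subst sum.remove[of _ "Suc r"]) auto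
  have "sum (?T (bs[Suc r := z])) ({..<length \<gamma>} - {r} - {Suc r}) =
      sum (?T bs) ({..<length \<gamma>} - {r} - {Suc r})"
    by (rule sum.cong) auto
  then show ?thesis
    using r len by (simp add: split)
qed

text \<open>Joint minimality over all gate points is tested only against lists that differ from the
  minimiser in the single entry \<open>r\<close>.\<close>

lemma geodesic_breaking_points_local_min:
  assumes geo: "geodesic_breaking_points P \<omega> p \<gamma> xs xt bs"
    and r: "Suc r < length \<gamma>"
    and z: "z \<in> common_face P (\<gamma> ! r) (\<gamma> ! Suc r)"
  shows "\<omega> (\<gamma> ! r) * lp_norm (p (\<gamma> ! r)) (bs ! Suc r - bs ! r)
      + \<omega> (\<gamma> ! Suc r) * lp_norm (p (\<gamma> ! Suc r)) (bs ! Suc (Suc r) - bs ! Suc r)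
    \<le> \<omega> (\<gamma> ! r) * lp_norm (p (\<gamma> ! r)) (z - bs ! r)
      + \<omega> (\<gamma> ! Suc r) * lp_norm (p (\<gamma> ! Suc r)) (bs ! Suc (Suc r) - z)"
proof -
  obtain ys where bs: "bs = xs # ys @ [xt]"
    and min: "is_arg_min (\<lambda>zs. path_length \<omega> p \<gamma> (xs # zs @ [xt])) (\<lambda>zs. zs \<in> gate_points P \<gamma>) ys"
    using geo by (auto simp: geodesic_breaking_points_def)
  have ys: "ys \<in> gate_points P \<gamma>"
    using min by (simp add: is_arg_min_def)
  then have len: "Suc (length ys) = length \<gamma>"
    by (simp add: gate_points_def)
  have "ys[r := z] \<in> gate_points P \<gamma>"
    using ys z r by (auto simp: gate_points_def nth_list_update)
  then have "path_length \<omega> p \<gamma> bs \<le> path_length \<omega> p \<gamma> (xs # ys[r := z] @ [xt])"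
    using min by (auto simp: is_arg_min_def bs not_less)
  \<comment> \<open>The leading \<open>xs\<close> shifts gate indices by one, and
    \<open>r < length ys\<close> keeps the update away from \<open>xt\<close>.\<close>
  also have "xs # ys[r := z] @ [xt] = bs[Suc r := z]"
    using r len by (simp add: bs list_update_append)
  finally show ?thesis
    using path_length_update[OF r, of bs \<omega> p z] len by (simp add: bs)
qed

text \<open>Both signs of \<open>u\<close> are allowed, which later yields an equation rather than a
  one-sided inequality.\<close>

lemma rel_interior_line:
  assumes b: "b \<in> rel_interior F" and v: "v \<in> difference_space (affine hull F)"
  obtains d where "0 < d" "\<And>u. \<bar>u\<bar> < d \<Longrightarrow> b + u *\<^sub>R v \<in> F"
proof -
  obtain e where e: "0 < e" "ball b e \<inter> affine hull F \<subseteq> F" and bF: "b \<in> F"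
    using b by (auto simp: mem_rel_interior_ball)
  obtain x y where xy: "x \<in> affine hull F" "y \<in> affine hull F" and v_eq: "v = x - y"
    using v by (auto simp: difference_space_def)
  show ?thesis
  proof
    \<comment> \<open>The summand 1 keeps the denominator positive when
      \<open>v = 0\<close>.\<close>
    show "0 < e / (norm v + 1)"
      using e(1) by (simp add: add_nonneg_pos)
  next
    fix u :: real
    assume u: "\<bar>u\<bar> < e / (norm v + 1)"
    have "\<bar>u\<bar> * norm v \<le> \<bar>u\<bar> * (norm v + 1)"
      by (simp add: mult_left_mono)
    also have "\<dots> < e"
      using u by (simp add: pos_less_divide_eq add_nonneg_pos)
    finally have "b + u *\<^sub>R v \<in> ball b e"
      by (simp add: dist_norm)
    moreover have "b + u *\<^sub>R v \<in> affine hull F"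
      using mem_affine_3_minus[OF affine_affine_hull hull_inc[OF bF] xy] by (simp add: v_eq)
    ultimately show "b + u *\<^sub>R v \<in> F"
      using e(2) by blast
  qed
qed

theorem corollary9:
  fixes P :: "nat \<Rightarrow> (real ^ 'd) set" and \<omega> p :: "nat \<Rightarrow> real"
    and m s t i j r :: nat and \<gamma> :: "nat list"
    and xs xt a b c :: "real ^ 'd" and bs :: "(real ^ 'd) list" and Fb :: "(real ^ 'd) set"
  assumes "polytopal_subdivision m P"
    and "\<And>l. l \<in> {1..m} \<Longrightarrow> \<omega> l > 0"
    and "\<And>l. l \<in> {1..m} \<Longrightarrow> 1 < p l"
    and "s \<in> {1..m}" and "t \<in> {1..m}" and "s \<noteq> t"
    and "xs \<in> P s" and "xt \<in> P t"
    and "\<gamma> \<in> simple_cell_paths m P s t"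
    and "geodesic_breaking_points P \<omega> p \<gamma> xs xt bs"
    and "Suc r < length \<gamma>" and "i = \<gamma> ! r" and "j = \<gamma> ! Suc r"
    and "a = bs ! r" and "b = bs ! Suc r" and "c = bs ! Suc (Suc r)"
    and "a \<in> P i - common_face P i j"
    and "b \<in> common_face P i j"
    and "c \<in> P j - common_face P i j"
    and "Fb face_of common_face P i j" and "b \<in> rel_interior Fb"
  shows "\<forall>v \<in> difference_space (affine hull Fb).
     \<omega> i * (polar_vec (p i) ((1 / lp_norm (p i) (b - a)) *\<^sub>R (b - a)) \<bullet> v) =
     \<omega> j * (polar_vec (p j) ((1 / lp_norm (p j) (c - b)) *\<^sub>R (c - b)) \<bullet> v)
   \<and>
     \<omega> i * (((1 / lp_norm (conj_exp (p i)) (polar_vec (p i) (b - a))) *\<^sub>R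
               polar_vec (p i) (b - a)) \<bullet> v) =
     \<omega> j * (((1 / lp_norm (conj_exp (p j)) (polar_vec (p j) (c - b))) *\<^sub>R
               polar_vec (p j) (c - b)) \<bullet> v)"
proof
  fix v
  assume v: "v \<in> difference_space (affine hull Fb)"
  have "set \<gamma> \<subseteq> {1..m}"
    using assms(9) by (simp add: simple_cell_paths_def)
  then have "i \<in> {1..m}" "j \<in> {1..m}"
    using assms(11-13) by (meson Suc_lessD nth_mem subsetD)+
  then have pi: "1 < p i" and pj: "1 < p j"
    using assms(3) by auto
  \<comment> \<open>Only \<open>b\<close> lies in the common face, so it differs from both
    neighbours and neither norm is evaluated at its singular point 0.\<close>
  have ba: "b - a \<noteq> 0" and cb: "c - b \<noteq> 0"
    using assms(17-19) by auto
  obtain d where d: "0 < d" "\<And>u. \<bar>u\<bar> < d \<Longrightarrow> b + u *\<^sub>R v \<in> Fb"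
    using rel_interior_line[OF assms(21) v] by blast
  \<comment> \<open>These are the two affected summands with \<open>b\<close> replaced by
    \<open>b + u *\<^sub>R v\<close>. The second difference moves along \<open>- v\<close>, so the
    two derivative terms enter with opposite signs.\<close>
  define f where "f u = \<omega> i * lp_norm (p i) ((b - a) + u *\<^sub>R v)
    + \<omega> j * lp_norm (p j) ((c - b) + u *\<^sub>R (- v))" for u
  let ?g = "polar_vec (p i) ((1 / lp_norm (p i) (b - a)) *\<^sub>R (b - a))"
  let ?h = "polar_vec (p j) ((1 / lp_norm (p j) (c - b)) *\<^sub>R (c - b))"
  have "(f has_real_derivative \<omega> i * (?g \<bullet> v) + \<omega> j * (?h \<bullet> (- v))) (at 0)"
    unfolding f_def
    by (intro DERIV_add DERIV_cmult has_real_derivative_lp_norm_line pi pj ba cb)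
  moreover have "f 0 \<le> f u" if "\<bar>0 - u\<bar> < d" for u
  proof -
    have "b + u *\<^sub>R v \<in> common_face P i j"
      using that d(2) face_of_imp_subset[OF assms(20)] by auto
    from geodesic_breaking_points_local_min[OF assms(10,11) this[unfolded assms(12,13)]]
    show ?thesis
      by (simp add: f_def assms(12-16) algebra_simps)
  qed
  \<comment> \<open>Fermat's criterion at the two-sided local minimum \<open>u = 0\<close>.\<close>
  ultimately have "\<omega> i * (?g \<bullet> v) + \<omega> j * (?h \<bullet> (- v)) = 0"
    using DERIV_local_min[OF _ d(1)] by blast
  then have "\<omega> i * (?g \<bullet> v) = \<omega> j * (?h \<bullet> v)"
    by simp
  then show "\<omega> i * (?g \<bullet> v) = \<omega> j * (?h \<bullet> v) \<and>
     \<omega> i * (((1 / lp_norm (conj_exp (p i)) (polar_vec (p i) (b - a))) *\<^sub>R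
               polar_vec (p i) (b - a)) \<bullet> v) =
     \<omega> j * (((1 / lp_norm (conj_exp (p j)) (polar_vec (p j) (c - b))) *\<^sub>R
               polar_vec (p j) (c - b)) \<bullet> v)"
    by (simp only: polar_vec_normalised pi pj ba cb simp_thms not_False_eq_True)
qed

end
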